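(* Let $R$ be an associative ring with unit and $M$ a left unital $R$-module. Assume $M$ is weakly supplemented. Then: (1) $M$ is semilocal; (2) $M = M_1 \oplus M_2$ with $M_1$ semisimple, $M_2$ semilocal and $\mathrm{Rad}(M)$ an essential submodule of $M_2$; (3) every factor module of $M$ is weakly supplemented; (4) any small cover of $M$ is weakly supplemented; (5) every supplement in $M$ and every direct summand of $M$ is weakly supplemented.
   Context: A submodule $N$ of $M$ is small, $N \ll M$, if $N + L \neq M$ for every proper submodule $L$ of $M$. A weak supplement of $N \subseteq M$ is a submodule $L \subseteq M$ with $N + L = M$ and $N \cap L \ll M$; $M$ is weakly supplemented if every submodule has a weak supplement in $M$. A supplement of $N$ in $M$ is a submodule $L$ minimal with respect to $N + L = M$ (equivalently $N + L = M$ and $N \cap L \ll L$); a supplement in $M$ is a submodule that is a supplement of some submodule of $M$. $\mathrm{Rad}(M)$ is the radical of $M$, the intersection of all maximal submodules ($=M$ if there are none). A module $X$ is semilocal if $X/\mathrm{Rad}(X)$ is semisimple. A module $N$ is a small cover of $M$ if there exists an epimorphism $f: N \to M$ with $\mathrm{Ker}(f) \ll N$. *)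

theory Defs
  imports "HOL-Algebra.Module" "HOL-Algebra.AbelCoset"
begin

text \<open>
  The locale \<^locale>\<open>module\<close> of HOL-Algebra is restricted to commutative rings. We use its record
  type and its notion of \<^locale>\<open>submodule\<close> (which does not depend on commutativity) and only
  relax the assumption on the ring. A submodule \<open>S\<close> of \<open>M\<close>, regarded as a module in its own right,
  is \<open>M\<lparr>carrier := S\<rparr>\<close>, as in HOL-Algebra.
\<close>

locale left_module = R?: ring R + M?: abelian_group M
  for R :: "('r, 'x) ring_scheme" (structure) and M :: "('r, 'm, 'y) module_scheme" (structure) +
  assumes smult_closed [simp, intro]:
      "\<lbrakk>a \<in> carrier R; x \<in> carrier M\<rbrakk> \<Longrightarrow> a \<odot>\<^bsub>M\<^esub> x \<in> carrier M"
    and smult_l_distr: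
      "\<lbrakk>a \<in> carrier R; b \<in> carrier R; x \<in> carrier M\<rbrakk> \<Longrightarrow>
        (a \<oplus>\<^bsub>R\<^esub> b) \<odot>\<^bsub>M\<^esub> x = a \<odot>\<^bsub>M\<^esub> x \<oplus>\<^bsub>M\<^esub> b \<odot>\<^bsub>M\<^esub> x"
    and smult_r_distr:
      "\<lbrakk>a \<in> carrier R; x \<in> carrier M; y \<in> carrier M\<rbrakk> \<Longrightarrow>
        a \<odot>\<^bsub>M\<^esub> (x \<oplus>\<^bsub>M\<^esub> y) = a \<odot>\<^bsub>M\<^esub> x \<oplus>\<^bsub>M\<^esub> a \<odot>\<^bsub>M\<^esub> y"
    and smult_assoc1:
      "\<lbrakk>a \<in> carrier R; b \<in> carrier R; x \<in> carrier M\<rbrakk> \<Longrightarrow>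
        (a \<otimes>\<^bsub>R\<^esub> b) \<odot>\<^bsub>M\<^esub> x = a \<odot>\<^bsub>M\<^esub> (b \<odot>\<^bsub>M\<^esub> x)"
    and smult_one [simp]:
      "x \<in> carrier M \<Longrightarrow> \<one>\<^bsub>R\<^esub> \<odot>\<^bsub>M\<^esub> x = x"

definition small_submodule ::
  "('r, 'x) ring_scheme \<Rightarrow> ('r, 'm, 'y) module_scheme \<Rightarrow> 'm set \<Rightarrow> bool" where
  "small_submodule R M N \<longleftrightarrow> submodule N R M \<and>
     (\<forall>L. submodule L R M \<and> L \<noteq> carrier M \<longrightarrow> N <+>\<^bsub>M\<^esub> L \<noteq> carrier M)"

definition weak_supplement ::
  "('r, 'x) ring_scheme \<Rightarrow> ('r, 'm, 'y) module_scheme \<Rightarrow> 'm set \<Rightarrow> 'm set \<Rightarrow> bool" where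
  "weak_supplement R M N L \<longleftrightarrow> submodule L R M \<and>
     N <+>\<^bsub>M\<^esub> L = carrier M \<and> small_submodule R M (N \<inter> L)"

definition weakly_supplemented ::
  "('r, 'x) ring_scheme \<Rightarrow> ('r, 'm, 'y) module_scheme \<Rightarrow> bool" where
  "weakly_supplemented R M \<longleftrightarrow> (\<forall>N. submodule N R M \<longrightarrow> (\<exists>L. weak_supplement R M N L))"

text \<open>\<open>supplement_of R M N L\<close>: \<open>L\<close> is a supplement of \<open>N\<close> in \<open>M\<close>.\<close>

definition supplement_of ::
  "('r, 'x) ring_scheme \<Rightarrow> ('r, 'm, 'y) module_scheme \<Rightarrow> 'm set \<Rightarrow> 'm set \<Rightarrow> bool" where
  "supplement_of R M N L \<longleftrightarrow> submodule L R M \<and> N <+>\<^bsub>M\<^esub> L = carrier M \<and>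
     (\<forall>L'. submodule L' R M \<and> L' \<subseteq> L \<and> N <+>\<^bsub>M\<^esub> L' = carrier M \<longrightarrow> L' = L)"

definition supplement_in ::
  "('r, 'x) ring_scheme \<Rightarrow> ('r, 'm, 'y) module_scheme \<Rightarrow> 'm set \<Rightarrow> bool" where
  "supplement_in R M L \<longleftrightarrow> (\<exists>N. submodule N R M \<and> supplement_of R M N L)"

definition direct_sum_decomp ::
  "('r, 'x) ring_scheme \<Rightarrow> ('r, 'm, 'y) module_scheme \<Rightarrow> 'm set \<Rightarrow> 'm set \<Rightarrow> bool" where
  "direct_sum_decomp R M A B \<longleftrightarrow> submodule A R M \<and> submodule B R M \<and>
     A <+>\<^bsub>M\<^esub> B = carrier M \<and> A \<inter> B = {\<zero>\<^bsub>M\<^esub>}"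

definition direct_summand ::
  "('r, 'x) ring_scheme \<Rightarrow> ('r, 'm, 'y) module_scheme \<Rightarrow> 'm set \<Rightarrow> bool" where
  "direct_summand R M A \<longleftrightarrow> (\<exists>B. direct_sum_decomp R M A B)"

definition essential_submodule ::
  "('r, 'x) ring_scheme \<Rightarrow> ('r, 'm, 'y) module_scheme \<Rightarrow> 'm set \<Rightarrow> bool" where
  "essential_submodule R M E \<longleftrightarrow> submodule E R M \<and>
     (\<forall>K. submodule K R M \<and> K \<noteq> {\<zero>\<^bsub>M\<^esub>} \<longrightarrow> E \<inter> K \<noteq> {\<zero>\<^bsub>M\<^esub>})"

definition maximal_submodule ::
  "('r, 'x) ring_scheme \<Rightarrow> ('r, 'm, 'y) module_scheme \<Rightarrow> 'm set \<Rightarrow> bool" where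
  "maximal_submodule R M K \<longleftrightarrow> submodule K R M \<and> K \<noteq> carrier M \<and>
     (\<forall>L. submodule L R M \<and> K \<subseteq> L \<longrightarrow> L = K \<or> L = carrier M)"

text \<open>Intersecting with the carrier gives \<open>Rad(M) = M\<close> if there are no maximal submodules.\<close>

definition radical :: "('r, 'x) ring_scheme \<Rightarrow> ('r, 'm, 'y) module_scheme \<Rightarrow> 'm set" where
  "radical R M = carrier M \<inter> \<Inter>{K. maximal_submodule R M K}"

definition simple_module :: "('r, 'x) ring_scheme \<Rightarrow> ('r, 'm, 'y) module_scheme \<Rightarrow> bool" where
  "simple_module R M \<longleftrightarrow> carrier M \<noteq> {\<zero>\<^bsub>M\<^esub>} \<and>
     (\<forall>K. submodule K R M \<longrightarrow> K = {\<zero>\<^bsub>M\<^esub>} \<or> K = carrier M)"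

text \<open>
  The sum of an arbitrary, possibly empty or infinite, family of submodules is the submodule
  generated by their union.
\<close>

definition submodule_sum ::
  "('r, 'x) ring_scheme \<Rightarrow> ('r, 'm, 'y) module_scheme \<Rightarrow> 'm set set \<Rightarrow> 'm set" where
  "submodule_sum R M \<A> = \<Inter>{K. submodule K R M \<and> \<Union>\<A> \<subseteq> K}"

text \<open>
  Semisimple means being the sum of all simple submodules. The zero module is semisimple (empty
  sum), but not simple.
\<close>

definition semisimple_module :: "('r, 'x) ring_scheme \<Rightarrow> ('r, 'm, 'y) module_scheme \<Rightarrow> bool" where
  "semisimple_module R M \<longleftrightarrow>
     carrier M = submodule_sum R M {S. submodule S R M \<and> simple_module R (M\<lparr>carrier := S\<rparr>)}"

text \<open>
  The elements of \<open>M / N\<close> are the cosets \<open>N + x\<close>, with \<open>a (N + x) = N + a x\<close>. The ring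
  multiplication fields of the module record are irrelevant.
\<close>

definition FactModule ::
  "('r, 'm, 'y) module_scheme \<Rightarrow> 'm set \<Rightarrow> ('r, 'm set) module" where
  "FactModule M N =
     \<lparr>carrier = a_rcosets\<^bsub>M\<^esub> N, mult = undefined, one = undefined,
      zero = N, add = set_add M,
      smult = (\<lambda>a X. \<Union>x\<in>X. N +>\<^bsub>M\<^esub> (a \<odot>\<^bsub>M\<^esub> x))\<rparr>"

definition semilocal_module :: "('r, 'x) ring_scheme \<Rightarrow> ('r, 'm, 'y) module_scheme \<Rightarrow> bool" where
  "semilocal_module R M \<longleftrightarrow> semisimple_module R (FactModule M (radical R M))"

definition left_module_hom ::
  "('r, 'x) ring_scheme \<Rightarrow> ('r, 'n, 'z) module_scheme \<Rightarrow> ('r, 'm, 'y) module_scheme \<Rightarrow>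
   ('n \<Rightarrow> 'm) set" where
  "left_module_hom R N M =
     {f. f \<in> carrier N \<rightarrow> carrier M \<and>
         (\<forall>x\<in>carrier N. \<forall>y\<in>carrier N. f (x \<oplus>\<^bsub>N\<^esub> y) = f x \<oplus>\<^bsub>M\<^esub> f y) \<and>
         (\<forall>a\<in>carrier R. \<forall>x\<in>carrier N. f (a \<odot>\<^bsub>N\<^esub> x) = a \<odot>\<^bsub>M\<^esub> f x)}"

text \<open>\<open>small_cover R N M\<close>: the module \<open>N\<close> is a small cover of \<open>M\<close>.\<close>

definition small_cover ::
  "('r, 'x) ring_scheme \<Rightarrow> ('r, 'n, 'z) module_scheme \<Rightarrow> ('r, 'm, 'y) module_scheme \<Rightarrow> bool" where
  "small_cover R N M \<longleftrightarrow> left_module R N \<and>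
     (\<exists>f \<in> left_module_hom R N M. f ` carrier N = carrier M \<and>
        small_submodule R N (a_kernel N M f))"

lemma (in left_module) left_module_submodule:
  assumes "submodule S R M"
  shows "left_module R (M\<lparr>carrier := S\<rparr>)"
proof -
  have sg: "subgroup S (add_monoid M)" and sc: "\<And>a x. a \<in> carrier R \<Longrightarrow> x \<in> S \<Longrightarrow> a \<odot>\<^bsub>M\<^esub> x \<in> S"
    using assms by (auto simp: submodule_def submodule_axioms_def)
  have sub: "S \<subseteq> carrier M"
    using subgroup.subset[OF sg] by simp
  have "abelian_group (M\<lparr>carrier := S\<rparr>)"
  proof (rule abelian_groupI)
    fix x assume x: "x \<in> carrier (M\<lparr>carrier := S\<rparr>)"
    then have "\<ominus>\<^bsub>M\<^esub> x \<in> S"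
      using subgroup.m_inv_closed[OF sg] by (simp add: a_inv_def)
    then show "\<exists>y\<in>carrier (M\<lparr>carrier := S\<rparr>). y \<oplus>\<^bsub>M\<lparr>carrier := S\<rparr>\<^esub> x = \<zero>\<^bsub>M\<lparr>carrier := S\<rparr>\<^esub>"
      using x sub by (auto intro!: bexI[of _ "\<ominus>\<^bsub>M\<^esub> x"] simp: M.l_neg)
  qed (use sub subgroup.m_closed[OF sg] subgroup.one_closed[OF sg] in
      \<open>auto simp: subset_iff M.a_ac\<close>)
  then show ?thesis
    using sub sc R.ring_axioms
    by (intro left_module.intro left_module_axioms.intro)
      (auto simp: subset_iff smult_l_distr smult_r_distr smult_assoc1)
qed

lemma (in left_module) left_module_FactModule:
  assumes "submodule N R M"
  shows "left_module R (FactModule M N)"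
proof -
  have sg: "subgroup N (add_monoid M)" and sc: "\<And>a x. a \<in> carrier R \<Longrightarrow> x \<in> N \<Longrightarrow> a \<odot>\<^bsub>M\<^esub> x \<in> N"
    using assms by (auto simp: submodule_def submodule_axioms_def)
  interpret N: abelian_subgroup N M
    using sg M.abelian_group_axioms by (intro abelian_subgroupI3 additive_subgroup.intro)
  have smult: "a \<odot>\<^bsub>FactModule M N\<^esub> (N +>\<^bsub>M\<^esub> x) = N +>\<^bsub>M\<^esub> (a \<odot>\<^bsub>M\<^esub> x)"
    if a: "a \<in> carrier R" and x: "x \<in> carrier M" for a x
  proof -
    have eq: "N +>\<^bsub>M\<^esub> (a \<odot>\<^bsub>M\<^esub> y) = N +>\<^bsub>M\<^esub> (a \<odot>\<^bsub>M\<^esub> x)" if y: "y \<in> N +>\<^bsub>M\<^esub> x" for y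
    proof -
      obtain n where n: "n \<in> N" "y = n \<oplus>\<^bsub>M\<^esub> x"
        using y by (auto simp: a_r_coset_def')
      then have "a \<odot>\<^bsub>M\<^esub> y = a \<odot>\<^bsub>M\<^esub> n \<oplus>\<^bsub>M\<^esub> a \<odot>\<^bsub>M\<^esub> x"
        using a x by (simp add: smult_r_distr)
      then have "a \<odot>\<^bsub>M\<^esub> y \<in> N +>\<^bsub>M\<^esub> (a \<odot>\<^bsub>M\<^esub> x)"
        using sc[OF a n(1)] by (auto simp: a_r_coset_def')
      then show ?thesis
        unfolding a_r_coset_def using a x sg
        by (intro M.a_repr_independence'[symmetric]) auto
    qed
    have x_in: "x \<in> N +>\<^bsub>M\<^esub> x"
      using x by (rule N.a_rcos_self)
    have "a \<odot>\<^bsub>FactModule M N\<^esub> (N +>\<^bsub>M\<^esub> x) = (\<Union>y\<in>N +>\<^bsub>M\<^esub> x. N +>\<^bsub>M\<^esub> (a \<odot>\<^bsub>M\<^esub> y))"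
      by (simp add: FactModule_def)
    also have "\<dots> = (\<Union>y\<in>N +>\<^bsub>M\<^esub> x. N +>\<^bsub>M\<^esub> (a \<odot>\<^bsub>M\<^esub> x))"
      by (intro SUP_cong refl) (rule eq)
    also have "\<dots> = N +>\<^bsub>M\<^esub> (a \<odot>\<^bsub>M\<^esub> x)"
      using x_in by blast
    finally show ?thesis .
  qed
  have carr: "carrier (FactModule M N) = (\<lambda>x. N +>\<^bsub>M\<^esub> x) ` carrier M"
    by (auto simp: FactModule_def A_RCOSETS_def')
  have add: "(N +>\<^bsub>M\<^esub> x) \<oplus>\<^bsub>FactModule M N\<^esub> (N +>\<^bsub>M\<^esub> y) = N +>\<^bsub>M\<^esub> (x \<oplus>\<^bsub>M\<^esub> y)"
    if "x \<in> carrier M" "y \<in> carrier M" for x y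
    using N.a_rcos_sum[OF that] by (simp add: FactModule_def)
  have zero: "\<zero>\<^bsub>FactModule M N\<^esub> = N +>\<^bsub>M\<^esub> \<zero>\<^bsub>M\<^esub>"
    using N.a_subset by (simp add: FactModule_def)
  have "abelian_group (FactModule M N)"
  proof (rule abelian_groupI)
    let ?Q = "FactModule M N"
    show "\<zero>\<^bsub>?Q\<^esub> \<in> carrier ?Q"
      unfolding carr zero by (rule imageI) (rule M.zero_closed)
    fix X assume "X \<in> carrier ?Q"
    then obtain x where x: "x \<in> carrier M" "X = N +>\<^bsub>M\<^esub> x"
      unfolding carr by blast
    show "\<zero>\<^bsub>?Q\<^esub> \<oplus>\<^bsub>?Q\<^esub> X = X"
      unfolding zero x(2) add[OF M.zero_closed x(1)] M.l_zero[OF x(1)] ..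
    show "\<exists>Y\<in>carrier ?Q. Y \<oplus>\<^bsub>?Q\<^esub> X = \<zero>\<^bsub>?Q\<^esub>"
    proof
      show "N +>\<^bsub>M\<^esub> (\<ominus>\<^bsub>M\<^esub> x) \<in> carrier ?Q"
        unfolding carr using x(1) by (intro imageI M.a_inv_closed)
      show "(N +>\<^bsub>M\<^esub> (\<ominus>\<^bsub>M\<^esub> x)) \<oplus>\<^bsub>?Q\<^esub> X = \<zero>\<^bsub>?Q\<^esub>"
        unfolding zero x(2) add[OF M.a_inv_closed[OF x(1)] x(1)] M.l_neg[OF x(1)] ..
    qed
    fix Y assume "Y \<in> carrier ?Q"
    then obtain y where y: "y \<in> carrier M" "Y = N +>\<^bsub>M\<^esub> y"
      unfolding carr by blast
    show "X \<oplus>\<^bsub>?Q\<^esub> Y \<in> carrier ?Q"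
      unfolding x(2) y(2) add[OF x(1) y(1)] carr using x(1) y(1) by (intro imageI M.a_closed)
    show "X \<oplus>\<^bsub>?Q\<^esub> Y = Y \<oplus>\<^bsub>?Q\<^esub> X"
      unfolding x(2) y(2) add[OF x(1) y(1)] add[OF y(1) x(1)] M.a_comm[OF x(1) y(1)] ..
    fix Z assume "Z \<in> carrier ?Q"
    then obtain z where z: "z \<in> carrier M" "Z = N +>\<^bsub>M\<^esub> z"
      unfolding carr by blast
    show "(X \<oplus>\<^bsub>?Q\<^esub> Y) \<oplus>\<^bsub>?Q\<^esub> Z = X \<oplus>\<^bsub>?Q\<^esub> (Y \<oplus>\<^bsub>?Q\<^esub> Z)"
      unfolding x(2) y(2) z(2)
      by (simp only: add x(1) y(1) z(1) M.a_closed M.a_assoc)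
  qed
  then show ?thesis
    using R.ring_axioms
    by (intro left_module.intro left_module_axioms.intro)
      (auto simp: carr smult add smult_l_distr smult_r_distr smult_assoc1)
qed

end

theory Submission
  imports Defs
begin

text \<open>
  Everything rests on three observations.

  Being weakly supplemented passes along an epimorphism \<open>f : A \<rightarrow> B\<close> in two ways. It descends from
  \<open>A\<close> to \<open>B\<close>, because \<open>f\<close> maps small submodules to small ones, so the image of a weak supplement of
  \<open>f\<^sup>-\<^sup>1(N)\<close> is a weak supplement of \<open>N\<close>. It ascends from \<open>B\<close> to \<open>A\<close> when the kernel is small, because
  then a submodule with small image is small, so the preimage of a weak supplement of \<open>f(N)\<close> is a weak
  supplement of \<open>N\<close>. This settles factor modules and small covers. If \<open>L\<close> is a supplement of \<open>N\<close>, then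
  \<open>L / (N \<inter> L)\<close> is isomorphic to \<open>M / N\<close> and \<open>N \<inter> L\<close> is small in \<open>L\<close>, so \<open>L\<close> is a small cover of
  \<open>M / N\<close> and inherits the property; a direct summand is a supplement of its complement.

  A weakly supplemented module with zero radical is semisimple: small submodules lie in the radical,
  so weak supplements are complements, and the maximal submodules, which now separate points,
  produce a simple submodule inside every nonzero submodule. Since \<open>M / Rad(M)\<close> is weakly
  supplemented and has zero radical, \<open>M\<close> is semilocal.

  For the decomposition, let \<open>M\<^sub>1\<close> be maximal among the submodules that meet \<open>Rad(M)\<close> trivially, and
  let \<open>M\<^sub>2 = P + Rad(M)\<close>, where \<open>P\<close> is a weak supplement of \<open>M\<^sub>1 + Rad(M)\<close>. The intersection of
  \<open>M\<^sub>1 + Rad(M)\<close> and \<open>M\<^sub>2\<close> is contained in \<open>Rad(M)\<close>, which makes the sum of \<open>M\<^sub>1\<close> and \<open>M\<^sub>2\<close> direct, and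
  the maximality of \<open>M\<^sub>1\<close> makes \<open>Rad(M)\<close> essential in \<open>M\<^sub>2\<close>. As direct summands, \<open>M\<^sub>1\<close> and \<open>M\<^sub>2\<close> are
  weakly supplemented, hence semilocal; and \<open>M\<^sub>1\<close> has zero radical, so that it is semisimple.
\<close>

section \<open>The lattice of submodules\<close>

context left_module
begin

lemma smult_zero: "a \<in> carrier R \<Longrightarrow> a \<odot>\<^bsub>M\<^esub> \<zero>\<^bsub>M\<^esub> = \<zero>\<^bsub>M\<^esub>"
  by (metis M.add.l_cancel_one' M.zero_closed M.r_zero smult_closed smult_r_distr)

lemma zero_smult: "x \<in> carrier M \<Longrightarrow> \<zero>\<^bsub>R\<^esub> \<odot>\<^bsub>M\<^esub> x = \<zero>\<^bsub>M\<^esub>"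
  by (metis M.add.l_cancel_one' R.r_zero R.zero_closed smult_closed smult_l_distr)

lemma smult_minus_one:
  assumes "x \<in> carrier M"
  shows "(\<ominus>\<^bsub>R\<^esub> \<one>\<^bsub>R\<^esub>) \<odot>\<^bsub>M\<^esub> x = \<ominus>\<^bsub>M\<^esub> x"
proof -
  have "(\<ominus>\<^bsub>R\<^esub> \<one>\<^bsub>R\<^esub>) \<odot>\<^bsub>M\<^esub> x \<oplus>\<^bsub>M\<^esub> x = (\<ominus>\<^bsub>R\<^esub> \<one>\<^bsub>R\<^esub> \<oplus>\<^bsub>R\<^esub> \<one>\<^bsub>R\<^esub>) \<odot>\<^bsub>M\<^esub> x"
    using assms by (simp add: smult_l_distr)
  also have "\<dots> = \<zero>\<^bsub>M\<^esub>"
    using assms by (simp add: R.l_neg zero_smult)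
  finally show ?thesis
    using assms by (metis M.minus_equality R.a_inv_closed R.one_closed smult_closed)
qed

text \<open>
  Closure under negation is multiplication by \<open>-1\<close>, so a homomorphism that respects sums and scalar
  multiples carries submodules to submodules, in both directions.
\<close>

lemma submoduleI:
  assumes sub: "S \<subseteq> carrier M" and "\<zero>\<^bsub>M\<^esub> \<in> S"
    and "\<And>x y. x \<in> S \<Longrightarrow> y \<in> S \<Longrightarrow> x \<oplus>\<^bsub>M\<^esub> y \<in> S"
    and sc: "\<And>a x. a \<in> carrier R \<Longrightarrow> x \<in> S \<Longrightarrow> a \<odot>\<^bsub>M\<^esub> x \<in> S"
  shows "submodule S R M"
proof -
  have neg: "\<ominus>\<^bsub>M\<^esub> x \<in> S" if "x \<in> S" for x
    using sc[of "\<ominus>\<^bsub>R\<^esub> \<one>\<^bsub>R\<^esub>" x] smult_minus_one[of x] that sub by auto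
  show ?thesis
    using assms neg
    by (intro submodule.intro subgroup.intro submodule_axioms.intro)
      (auto simp: a_inv_def[symmetric])
qed

lemma submoduleD:
  assumes "submodule S R M"
  shows "S \<subseteq> carrier M" and "\<zero>\<^bsub>M\<^esub> \<in> S"
    and "\<And>x y. x \<in> S \<Longrightarrow> y \<in> S \<Longrightarrow> x \<oplus>\<^bsub>M\<^esub> y \<in> S"
    and "\<And>a x. a \<in> carrier R \<Longrightarrow> x \<in> S \<Longrightarrow> a \<odot>\<^bsub>M\<^esub> x \<in> S"
    and "\<And>x. x \<in> S \<Longrightarrow> \<ominus>\<^bsub>M\<^esub> x \<in> S"
proof -
  interpret S: submodule S R M by (rule assms)
  show "S \<subseteq> carrier M" and "\<zero>\<^bsub>M\<^esub> \<in> S"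
    using S.subset S.one_closed by auto
  show "x \<oplus>\<^bsub>M\<^esub> y \<in> S" if "x \<in> S" "y \<in> S" for x y
    using S.m_closed[OF that] by simp
  show "a \<odot>\<^bsub>M\<^esub> x \<in> S" if "a \<in> carrier R" "x \<in> S" for a x
    using that by (rule S.smult_closed)
  show "\<ominus>\<^bsub>M\<^esub> x \<in> S" if "x \<in> S" for x
    using S.m_inv_closed[OF that] by (simp add: a_inv_def)
qed

lemma submodule_carrier: "submodule (carrier M) R M"
  by (rule submoduleI) auto

lemma submodule_zero: "submodule {\<zero>\<^bsub>M\<^esub>} R M"
  by (rule submoduleI) (auto simp: smult_zero)

lemma submodule_Int: "submodule N R M \<Longrightarrow> submodule L R M \<Longrightarrow> submodule (N \<inter> L) R M"
  by (rule submoduleI) (auto dest: submoduleD)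

lemma submodule_Inter:
  assumes "\<And>K. K \<in> \<K> \<Longrightarrow> submodule K R M"
  shows "submodule (carrier M \<inter> \<Inter>\<K>) R M"
  by (rule submoduleI) (auto dest: assms submoduleD)

lemma submodule_radical: "submodule (radical R M) R M"
  unfolding radical_def by (rule submodule_Inter) (simp add: maximal_submodule_def)

lemma submodule_cancel:
  assumes S: "submodule S R M" and "a \<in> S" and b: "b \<in> carrier M" and "a \<oplus>\<^bsub>M\<^esub> b \<in> S"
  shows "b \<in> S"
proof -
  have "\<ominus>\<^bsub>M\<^esub> a \<oplus>\<^bsub>M\<^esub> (a \<oplus>\<^bsub>M\<^esub> b) \<in> S"
    using assms by (simp add: submoduleD(3,5)[OF S])
  moreover have "a \<in> carrier M"
    using assms submoduleD(1) by blast
  ultimately show ?thesis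
    using b by (simp add: M.r_neg1)
qed

lemma submodule_cancel':
  assumes "submodule S R M" and "a \<in> carrier M" and "b \<in> S" and "a \<oplus>\<^bsub>M\<^esub> b \<in> S"
  shows "a \<in> S"
  using submodule_cancel[of S b a] assms submoduleD(1)[OF assms(1)] by (auto simp: M.a_comm subset_iff)

lemma mem_sum: "x \<in> N <+>\<^bsub>M\<^esub> L \<longleftrightarrow> (\<exists>n\<in>N. \<exists>l\<in>L. x = n \<oplus>\<^bsub>M\<^esub> l)"
  by (auto simp: set_add_def')

lemma submodule_set_add:
  assumes N: "submodule N R M" and L: "submodule L R M"
  shows "submodule (N <+>\<^bsub>M\<^esub> L) R M"
proof (rule submoduleI)
  note sub = submoduleD(1)[OF N, THEN subsetD] submoduleD(1)[OF L, THEN subsetD]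
  show "N <+>\<^bsub>M\<^esub> L \<subseteq> carrier M"
    using sub by (auto simp: mem_sum)
  show "\<zero>\<^bsub>M\<^esub> \<in> N <+>\<^bsub>M\<^esub> L"
    unfolding mem_sum using submoduleD(2)[OF N] submoduleD(2)[OF L] by force
  show "x \<oplus>\<^bsub>M\<^esub> y \<in> N <+>\<^bsub>M\<^esub> L" if xy: "x \<in> N <+>\<^bsub>M\<^esub> L" "y \<in> N <+>\<^bsub>M\<^esub> L" for x y
  proof -
    obtain n l n' l' where e: "n \<in> N" "l \<in> L" "x = n \<oplus>\<^bsub>M\<^esub> l" "n' \<in> N" "l' \<in> L" "y = n' \<oplus>\<^bsub>M\<^esub> l'"
      using xy by (auto simp: mem_sum)
    then have "x \<oplus>\<^bsub>M\<^esub> y = (n \<oplus>\<^bsub>M\<^esub> n') \<oplus>\<^bsub>M\<^esub> (l \<oplus>\<^bsub>M\<^esub> l')"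
      by (simp add: sub M.a_ac)
    then show ?thesis
      unfolding mem_sum using e submoduleD(3)[OF N] submoduleD(3)[OF L] by blast
  qed
  show "a \<odot>\<^bsub>M\<^esub> x \<in> N <+>\<^bsub>M\<^esub> L" if a: "a \<in> carrier R" and x: "x \<in> N <+>\<^bsub>M\<^esub> L" for a x
  proof -
    obtain n l where e: "n \<in> N" "l \<in> L" "x = n \<oplus>\<^bsub>M\<^esub> l"
      using x by (auto simp: mem_sum)
    then have "a \<odot>\<^bsub>M\<^esub> x = a \<odot>\<^bsub>M\<^esub> n \<oplus>\<^bsub>M\<^esub> a \<odot>\<^bsub>M\<^esub> l"
      using a by (simp add: sub smult_r_distr)
    then show ?thesis
      unfolding mem_sum using e a submoduleD(4)[OF N] submoduleD(4)[OF L] by blast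
  qed
qed

lemma set_add_comm:
  assumes "N \<subseteq> carrier M" and "L \<subseteq> carrier M"
  shows "N <+>\<^bsub>M\<^esub> L = L <+>\<^bsub>M\<^esub> N"
  using assms by (auto simp: mem_sum subset_iff) (metis M.a_comm)+

lemma set_add_upper1:
  assumes "N \<subseteq> carrier M" and "submodule L R M"
  shows "N \<subseteq> N <+>\<^bsub>M\<^esub> L"
  using assms submoduleD(2)[OF assms(2)] by (force simp: mem_sum)

lemma set_add_upper2:
  assumes "submodule N R M" and "L \<subseteq> carrier M"
  shows "L \<subseteq> N <+>\<^bsub>M\<^esub> L"
  using assms submoduleD(2)[OF assms(1)] by (force simp: mem_sum)

lemma set_add_least:
  assumes "submodule K R M" and "N \<subseteq> K" and "L \<subseteq> K"
  shows "N <+>\<^bsub>M\<^esub> L \<subseteq> K"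
  using assms(2,3) submoduleD(3)[OF assms(1)] by (fastforce simp: mem_sum)

lemma submodule_submodule_sum:
  "submodule (submodule_sum R M \<A>) R M" if "\<Union>\<A> \<subseteq> carrier M"
proof -
  have "submodule_sum R M \<A> = carrier M \<inter> \<Inter>{K. submodule K R M \<and> \<Union>\<A> \<subseteq> K}"
    unfolding submodule_sum_def using that submodule_carrier by auto
  then show ?thesis
    using submodule_Inter[of "{K. submodule K R M \<and> \<Union>\<A> \<subseteq> K}"] by simp
qed

lemma submodule_restrict_iff:
  assumes S: "submodule S R M"
  shows "submodule K R (M\<lparr>carrier := S\<rparr>) \<longleftrightarrow> submodule K R M \<and> K \<subseteq> S"
proof -
  interpret S: left_module R "M\<lparr>carrier := S\<rparr>"
    by (rule left_module_submodule[OF S])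
  show ?thesis
  proof
    assume K: "submodule K R (M\<lparr>carrier := S\<rparr>)"
    have "submodule K R M"
      using S.submoduleD[OF K] submoduleD(1)[OF S] by (intro submoduleI) auto
    then show "submodule K R M \<and> K \<subseteq> S"
      using S.submoduleD(1)[OF K] by simp
  next
    assume "submodule K R M \<and> K \<subseteq> S"
    then show "submodule K R (M\<lparr>carrier := S\<rparr>)"
      using submoduleD[of K] by (intro S.submoduleI) auto
  qed
qed

lemma set_add_restrict: "N <+>\<^bsub>M\<lparr>carrier := S\<rparr>\<^esub> L = N <+>\<^bsub>M\<^esub> L"
  by (simp add: set_add_def')

end

section \<open>Small submodules and the radical\<close>

context left_module
begin

lemma small_submoduleI:
  assumes "submodule N R M"
    and "\<And>L. submodule L R M \<Longrightarrow> N <+>\<^bsub>M\<^esub> L = carrier M \<Longrightarrow> L = carrier M"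
  shows "small_submodule R M N"
  using assms unfolding small_submodule_def by blast

lemma small_submoduleD:
  assumes "small_submodule R M N" and "submodule L R M" and "carrier M \<subseteq> N <+>\<^bsub>M\<^esub> L"
  shows "L = carrier M"
  using assms submoduleD(1)[OF submodule_set_add[of N L]]
  unfolding small_submodule_def by blast

lemma small_submodule_subset:
  assumes N: "small_submodule R M N" and K: "submodule K R M" and "K \<subseteq> N"
  shows "small_submodule R M K"
proof (rule small_submoduleI[OF K])
  fix L assume L: "submodule L R M" and "K <+>\<^bsub>M\<^esub> L = carrier M"
  then have "carrier M \<subseteq> N <+>\<^bsub>M\<^esub> L"
    using \<open>K \<subseteq> N\<close> by (auto simp: mem_sum) (metis mem_sum subsetD)
  then show "L = carrier M"
    by (rule small_submoduleD[OF N L])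
qed

text \<open>
  If a maximal submodule \<open>K\<close> did not contain \<open>N\<close>, then \<open>N + K = M\<close> although \<open>K\<close> is proper.
\<close>

lemma small_submodule_subset_radical:
  assumes N: "small_submodule R M N"
  shows "N \<subseteq> radical R M"
proof -
  have sub: "submodule N R M"
    using N by (simp add: small_submodule_def)
  have "N \<subseteq> K" if "maximal_submodule R M K" for K
  proof -
    have K: "submodule K R M" "K \<noteq> carrier M"
      and max: "\<And>L. submodule L R M \<Longrightarrow> K \<subseteq> L \<Longrightarrow> L = K \<or> L = carrier M"
      using that by (auto simp: maximal_submodule_def)
    have "N <+>\<^bsub>M\<^esub> K \<noteq> carrier M"
      using N K by (simp add: small_submodule_def)
    then have "N <+>\<^bsub>M\<^esub> K = K"
      using max[OF submodule_set_add[OF sub K(1)]] set_add_upper2[OF sub submoduleD(1)[OF K(1)]]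
      by blast
    then show ?thesis
      using set_add_upper1[OF submoduleD(1)[OF sub] K(1)] by simp
  qed
  then show ?thesis
    using submoduleD(1)[OF sub] by (auto simp: radical_def)
qed

text \<open>
  A maximal submodule of \<open>M\<close> either contains \<open>S\<close> or cuts out a maximal submodule of \<open>S\<close>.
\<close>

lemma radical_restrict_subset:
  assumes S: "submodule S R M"
  shows "radical R (M\<lparr>carrier := S\<rparr>) \<subseteq> radical R M"
proof
  fix x assume x: "x \<in> radical R (M\<lparr>carrier := S\<rparr>)"
  then have xS: "x \<in> S"
    by (simp add: radical_def)
  have "x \<in> K" if "maximal_submodule R M K" for K
  proof (cases "S \<subseteq> K")
    case False
    have K: "submodule K R M"
      and max: "\<And>L. submodule L R M \<Longrightarrow> K \<subseteq> L \<Longrightarrow> L = K \<or> L = carrier M"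
      using that by (auto simp: maximal_submodule_def)
    have KS: "submodule (K \<inter> S) R M"
      by (rule submodule_Int[OF K S])
    have "maximal_submodule R (M\<lparr>carrier := S\<rparr>) (K \<inter> S)"
      unfolding maximal_submodule_def submodule_restrict_iff[OF S]
    proof (intro conjI allI impI)
      show "K \<inter> S \<noteq> carrier (M\<lparr>carrier := S\<rparr>)"
        using False by auto
      fix L assume "(submodule L R M \<and> L \<subseteq> S) \<and> K \<inter> S \<subseteq> L"
      then have L: "submodule L R M" "L \<subseteq> S" "K \<inter> S \<subseteq> L"
        by auto
      have up: "K \<subseteq> K <+>\<^bsub>M\<^esub> L" "L \<subseteq> K <+>\<^bsub>M\<^esub> L"
        using set_add_upper1 set_add_upper2 submoduleD(1) K L(1) by auto
      from max[OF submodule_set_add[OF K L(1)] up(1)]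
      show "L = K \<inter> S \<or> L = carrier (M\<lparr>carrier := S\<rparr>)"
      proof
        assume "K <+>\<^bsub>M\<^esub> L = K"
        then show ?thesis
          using up L by auto
      next
        assume KL: "K <+>\<^bsub>M\<^esub> L = carrier M"
        have "s \<in> L" if s: "s \<in> S" for s
        proof -
          obtain k l where kl: "k \<in> K" "l \<in> L" "s = k \<oplus>\<^bsub>M\<^esub> l"
            using KL s submoduleD(1)[OF S] mem_sum[of s K L] by auto
          then have "k \<in> S"
            using submodule_cancel'[OF S, of k l] L(2) s submoduleD(1)[OF K] by auto
          then show ?thesis
            using kl L(3) submoduleD(3)[OF L(1)] by auto
        qed
        then show ?thesis
          using L(2) by auto
      qed
    qed (use KS in auto)
    then show ?thesis
      using x by (auto simp: radical_def)
  qed (use xS in auto)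
  then show "x \<in> radical R M"
    using xS submoduleD(1)[OF S] by (auto simp: radical_def)
qed

end

section \<open>Transfer along epimorphisms\<close>

locale left_module_epi = A: left_module R A + B: left_module R B
  for R :: "('r, 'x) ring_scheme" and A :: "('r, 'a, 'y) module_scheme"
    and B :: "('r, 'b, 'z) module_scheme" +
  fixes f :: "'a \<Rightarrow> 'b"
  assumes hom: "f \<in> left_module_hom R A B"
    and surj: "f ` carrier A = carrier B"
begin

lemma closed: "x \<in> carrier A \<Longrightarrow> f x \<in> carrier B"
  using hom by (auto simp: left_module_hom_def)

lemma map_add: "x \<in> carrier A \<Longrightarrow> y \<in> carrier A \<Longrightarrow> f (x \<oplus>\<^bsub>A\<^esub> y) = f x \<oplus>\<^bsub>B\<^esub> f y"
  using hom by (auto simp: left_module_hom_def)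

lemma map_smult: "a \<in> carrier R \<Longrightarrow> x \<in> carrier A \<Longrightarrow> f (a \<odot>\<^bsub>A\<^esub> x) = a \<odot>\<^bsub>B\<^esub> f x"
  using hom by (auto simp: left_module_hom_def)

lemma map_zero: "f \<zero>\<^bsub>A\<^esub> = \<zero>\<^bsub>B\<^esub>"
  using map_smult[of "\<zero>\<^bsub>R\<^esub>" "\<zero>\<^bsub>A\<^esub>"] closed[of "\<zero>\<^bsub>A\<^esub>"]
  by (simp add: A.zero_smult B.zero_smult)

lemma mem_kernel: "x \<in> a_kernel A B f \<longleftrightarrow> x \<in> carrier A \<and> f x = \<zero>\<^bsub>B\<^esub>"
  by (auto simp: a_kernel_def')

lemma submodule_image:
  assumes "submodule K R A"
  shows "submodule (f ` K) R B"
proof (rule B.submoduleI)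
  note K = A.submoduleD[OF assms]
  show "f ` K \<subseteq> carrier B"
    using K(1) closed by auto
  show "\<zero>\<^bsub>B\<^esub> \<in> f ` K"
    using K(2) map_zero by force
  show "x \<oplus>\<^bsub>B\<^esub> y \<in> f ` K" if "x \<in> f ` K" "y \<in> f ` K" for x y
    using that K(1,3) by (auto simp: subset_iff map_add[symmetric])
  show "a \<odot>\<^bsub>B\<^esub> x \<in> f ` K" if "a \<in> carrier R" "x \<in> f ` K" for a x
    using that K(1,4) by (auto simp: subset_iff map_smult[symmetric])
qed

definition preimage :: "'b set \<Rightarrow> 'a set" where
  "preimage L = {x \<in> carrier A. f x \<in> L}"

lemma submodule_preimage:
  assumes "submodule L R B"
  shows "submodule (preimage L) R A"
  using B.submoduleD[OF assms]
  by (intro A.submoduleI) (auto simp: preimage_def map_add map_smult map_zero)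

lemma image_preimage:
  assumes "submodule L R B"
  shows "f ` preimage L = L"
  using B.submoduleD(1)[OF assms] surj by (auto simp: preimage_def)

lemma image_set_add:
  assumes "N \<subseteq> carrier A" and "L \<subseteq> carrier A"
  shows "f ` (N <+>\<^bsub>A\<^esub> L) = f ` N <+>\<^bsub>B\<^esub> f ` L"
proof
  show "f ` (N <+>\<^bsub>A\<^esub> L) \<subseteq> f ` N <+>\<^bsub>B\<^esub> f ` L"
    using assms by (auto simp: A.mem_sum B.mem_sum subset_iff map_add) blast
  show "f ` N <+>\<^bsub>B\<^esub> f ` L \<subseteq> f ` (N <+>\<^bsub>A\<^esub> L)"
    using assms by (auto simp: B.mem_sum subset_iff map_add[symmetric]) (use A.mem_sum in blast)
qed

text \<open>
  A submodule containing the kernel is determined by its image: two elements with the same image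
  differ by an element of the kernel.
\<close>

lemma mem_of_image_mem:
  assumes K: "submodule K R A" and ker: "a_kernel A B f \<subseteq> K"
    and x: "x \<in> carrier A" and fx: "f x \<in> f ` K"
  shows "x \<in> K"
proof -
  obtain k where k: "k \<in> K" "f x = f k"
    using fx by auto
  have kA: "k \<in> carrier A"
    using k A.submoduleD(1)[OF K] by auto
  have nk: "\<ominus>\<^bsub>A\<^esub> k \<in> K"
    using k A.submoduleD(5)[OF K] by auto
  have "f (x \<oplus>\<^bsub>A\<^esub> \<ominus>\<^bsub>A\<^esub> k) = f (k \<oplus>\<^bsub>A\<^esub> \<ominus>\<^bsub>A\<^esub> k)"
    using x kA k by (simp add: map_add)
  then have "x \<oplus>\<^bsub>A\<^esub> \<ominus>\<^bsub>A\<^esub> k \<in> K"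
    using x kA map_zero ker by (auto simp: A.M.r_neg mem_kernel subset_iff)
  then show ?thesis
    using A.submodule_cancel'[OF K x nk] by simp
qed

lemma preimage_image:
  assumes "submodule K R A" and "a_kernel A B f \<subseteq> K"
  shows "preimage (f ` K) = K"
  using mem_of_image_mem[OF assms] A.submoduleD(1)[OF assms(1)] by (auto simp: preimage_def)

lemma preimage_carrier: "preimage (carrier B) = carrier A"
  using closed by (auto simp: preimage_def)

lemma kernel_subset_preimage:
  assumes "submodule L R B"
  shows "a_kernel A B f \<subseteq> preimage L"
  using B.submoduleD(2)[OF assms] by (auto simp: preimage_def mem_kernel)

text \<open>
  If \<open>f(K) + L = B\<close>, then \<open>K + f\<^sup>-\<^sup>1(L)\<close> has image \<open>B\<close> and contains the kernel, so it is all of \<open>A\<close>.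
\<close>

lemma small_submodule_image:
  assumes K: "small_submodule R A K"
  shows "small_submodule R B (f ` K)"
proof (rule B.small_submoduleI)
  have sub: "submodule K R A"
    using K by (simp add: small_submodule_def)
  then show "submodule (f ` K) R B"
    by (rule submodule_image)
  fix L assume L: "submodule L R B" and sum: "f ` K <+>\<^bsub>B\<^esub> L = carrier B"
  note P = submodule_preimage[OF L]
  have KP: "submodule (K <+>\<^bsub>A\<^esub> preimage L) R A"
    by (rule A.submodule_set_add[OF sub P])
  have "f ` (K <+>\<^bsub>A\<^esub> preimage L) = carrier B"
    using sum image_preimage[OF L] image_set_add A.submoduleD(1)[OF sub] A.submoduleD(1)[OF P]
    by simp
  moreover have "a_kernel A B f \<subseteq> K <+>\<^bsub>A\<^esub> preimage L"
    using kernel_subset_preimage[OF L] A.set_add_upper2[OF sub A.submoduleD(1)[OF P]] by blast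
  ultimately have "carrier A \<subseteq> K <+>\<^bsub>A\<^esub> preimage L"
    using mem_of_image_mem[OF KP] closed by blast
  then have "preimage L = carrier A"
    by (rule A.small_submoduleD[OF K P])
  then show "L = carrier B"
    using image_preimage[OF L] surj by simp
qed

text \<open>
  If \<open>L\<close> is a weak supplement of \<open>f\<^sup>-\<^sup>1(N)\<close>, then \<open>N \<inter> f(L)\<close> is exactly the image of the small
  submodule \<open>f\<^sup>-\<^sup>1(N) \<inter> L\<close>, so \<open>f(L)\<close> is a weak supplement of \<open>N\<close>.
\<close>

theorem weakly_supplemented_image:
  assumes ws: "weakly_supplemented R A"
  shows "weakly_supplemented R B"
  unfolding weakly_supplemented_def
proof (intro allI impI)
  fix N assume N: "submodule N R B"
  note P = submodule_preimage[OF N]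
  obtain L where L: "submodule L R A" "preimage N <+>\<^bsub>A\<^esub> L = carrier A"
      "small_submodule R A (preimage N \<inter> L)"
    using ws P by (auto simp: weakly_supplemented_def weak_supplement_def)
  have "N <+>\<^bsub>B\<^esub> f ` L = carrier B"
    using image_set_add[of "preimage N" L] A.submoduleD(1)[OF P] A.submoduleD(1)[OF L(1)]
    by (simp add: L(2) surj image_preimage[OF N])
  moreover have "f ` (preimage N \<inter> L) = N \<inter> f ` L"
    using A.submoduleD(1)[OF L(1)] by (auto simp: preimage_def)
  then have "small_submodule R B (N \<inter> f ` L)"
    using small_submodule_image[OF L(3)] by simp
  ultimately show "\<exists>L. weak_supplement R B N L"
    using submodule_image[OF L(1)] by (auto simp: weak_supplement_def)
qed

text \<open>
  If \<open>K + T = A\<close>, then applying \<open>f\<close> and using that \<open>f(K)\<close> is small gives \<open>f(T) = B\<close>, that is,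
  \<open>Ker(f) + T = A\<close>; smallness of the kernel finishes.
\<close>

lemma small_submodule_of_image:
  assumes ker: "small_submodule R A (a_kernel A B f)"
    and K: "submodule K R A" and small: "small_submodule R B (f ` K)"
  shows "small_submodule R A K"
proof (rule A.small_submoduleI[OF K])
  fix T assume T: "submodule T R A" and sum: "K <+>\<^bsub>A\<^esub> T = carrier A"
  have kerA: "submodule (a_kernel A B f) R A"
    using ker by (simp add: small_submodule_def)
  have KT: "submodule (a_kernel A B f <+>\<^bsub>A\<^esub> T) R A"
    by (rule A.submodule_set_add[OF kerA T])
  have "f ` K <+>\<^bsub>B\<^esub> f ` T = carrier B"
    using image_set_add[of K T] A.submoduleD(1)[OF K] A.submoduleD(1)[OF T] sum surj by simp
  then have "f ` T = carrier B"
    using B.small_submoduleD[OF small submodule_image[OF T]] by simp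
  then have "carrier B \<subseteq> f ` (a_kernel A B f <+>\<^bsub>A\<^esub> T)"
    using A.set_add_upper2[OF kerA A.submoduleD(1)[OF T]] by blast
  moreover have "a_kernel A B f \<subseteq> a_kernel A B f <+>\<^bsub>A\<^esub> T"
    by (rule A.set_add_upper1[OF A.submoduleD(1)[OF kerA] T])
  ultimately have "carrier A \<subseteq> a_kernel A B f <+>\<^bsub>A\<^esub> T"
    using mem_of_image_mem[OF KT] closed by blast
  then show "T = carrier A"
    by (rule A.small_submoduleD[OF ker T])
qed

text \<open>
  If \<open>L\<close> is a weak supplement of \<open>f(N)\<close>, then \<open>f\<close> maps \<open>N \<inter> f\<^sup>-\<^sup>1(L)\<close> into the small submodule
  \<open>f(N) \<inter> L\<close>, so that \<open>f\<^sup>-\<^sup>1(L)\<close> is a weak supplement of \<open>N\<close>.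
\<close>

theorem weakly_supplemented_small_cover:
  assumes ker: "small_submodule R A (a_kernel A B f)"
    and ws: "weakly_supplemented R B"
  shows "weakly_supplemented R A"
  unfolding weakly_supplemented_def
proof (intro allI impI)
  fix N assume N: "submodule N R A"
  obtain L where L: "submodule L R B" "f ` N <+>\<^bsub>B\<^esub> L = carrier B"
      "small_submodule R B (f ` N \<inter> L)"
    using ws submodule_image[OF N] by (auto simp: weakly_supplemented_def weak_supplement_def)
  note P = submodule_preimage[OF L(1)]
  have NP: "submodule (N <+>\<^bsub>A\<^esub> preimage L) R A" and NiP: "submodule (N \<inter> preimage L) R A"
    using A.submodule_set_add[OF N P] A.submodule_Int[OF N P] by auto
  have "f ` (N <+>\<^bsub>A\<^esub> preimage L) = carrier B"
    using image_set_add[of N "preimage L"] A.submoduleD(1)[OF N] A.submoduleD(1)[OF P]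
    by (simp add: image_preimage[OF L(1)] L(2))
  moreover have "a_kernel A B f \<subseteq> N <+>\<^bsub>A\<^esub> preimage L"
    using kernel_subset_preimage[OF L(1)] A.set_add_upper2[OF N A.submoduleD(1)[OF P]] by blast
  ultimately have "N <+>\<^bsub>A\<^esub> preimage L = carrier A"
    using mem_of_image_mem[OF NP] closed A.submoduleD(1)[OF NP] by blast
  moreover have "small_submodule R B (f ` (N \<inter> preimage L))"
    by (rule B.small_submodule_subset[OF L(3) submodule_image[OF NiP]]) (auto simp: preimage_def)
  then have "small_submodule R A (N \<inter> preimage L)"
    by (rule small_submodule_of_image[OF ker NiP])
  ultimately show "\<exists>L. weak_supplement R A N L"
    using P by (auto simp: weak_supplement_def)
qed

text \<open>
  A point outside the radical is missed by some maximal submodule, which contains the kernel;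
  the image of that submodule is maximal and misses the image of the point.
\<close>

lemma radical_image_zero:
  assumes ker: "a_kernel A B f = radical R A"
  shows "radical R B = {\<zero>\<^bsub>B\<^esub>}"
proof -
  have "y = \<zero>\<^bsub>B\<^esub>" if y: "y \<in> radical R B" for y
  proof (rule ccontr)
    assume "y \<noteq> \<zero>\<^bsub>B\<^esub>"
    obtain x where x: "x \<in> carrier A" "y = f x"
      using y surj by (auto simp: radical_def)
    then have "x \<notin> radical R A"
      using \<open>y \<noteq> \<zero>\<^bsub>B\<^esub>\<close> ker mem_kernel by blast
    then obtain K where "maximal_submodule R A K" and xK: "x \<notin> K"
      using x by (auto simp: radical_def)
    then have K: "submodule K R A" "K \<noteq> carrier A"
      and max: "\<And>L. submodule L R A \<Longrightarrow> K \<subseteq> L \<Longrightarrow> L = K \<or> L = carrier A"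
      and kerK: "a_kernel A B f \<subseteq> K"
      by (auto simp: maximal_submodule_def ker radical_def)
    have "maximal_submodule R B (f ` K)"
      unfolding maximal_submodule_def
    proof (intro conjI allI impI)
      show "submodule (f ` K) R B"
        by (rule submodule_image[OF K(1)])
      show "f ` K \<noteq> carrier B"
        using preimage_image[OF K(1) kerK] preimage_carrier K(2) by auto
      fix L assume L: "submodule L R B \<and> f ` K \<subseteq> L"
      then have "K \<subseteq> preimage L"
        using A.submoduleD(1)[OF K(1)] by (auto simp: preimage_def)
      then show "L = f ` K \<or> L = carrier B"
        using max[of "preimage L"] submodule_preimage[of L] image_preimage[of L] surj L by auto
    qed
    then have "f x \<in> f ` K"
      using y x by (auto simp: radical_def)
    then show False
      using mem_of_image_mem[OF K(1) kerK x(1)] xK by simp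
  qed
  then show ?thesis
    using B.submoduleD(2)[OF B.submodule_radical] by blast
qed

end

section \<open>Factor modules and supplements\<close>

context left_module
begin

context
  fixes N assumes N: "submodule N R M"
begin

interpretation N: abelian_subgroup N M
  using N M.abelian_group_axioms
  by (intro abelian_subgroupI3 additive_subgroup.intro) (auto simp: submodule_def)

lemma coset_cong:
  assumes "x \<in> carrier M" and "y \<in> N +>\<^bsub>M\<^esub> x"
  shows "N +>\<^bsub>M\<^esub> y = N +>\<^bsub>M\<^esub> x"
  using M.a_repr_independence'[of y N x] assms N.a_subgroup by (simp add: a_r_coset_def)

lemma carrier_FactModule: "carrier (FactModule M N) = (\<lambda>x. N +>\<^bsub>M\<^esub> x) ` carrier M"
  by (auto simp: FactModule_def A_RCOSETS_def')

lemma coset_hom: "(\<lambda>x. N +>\<^bsub>M\<^esub> x) \<in> left_module_hom R M (FactModule M N)"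
proof -
  have "N +>\<^bsub>M\<^esub> (a \<odot>\<^bsub>M\<^esub> x) = (\<Union>y\<in>N +>\<^bsub>M\<^esub> x. N +>\<^bsub>M\<^esub> (a \<odot>\<^bsub>M\<^esub> y))"
    if a: "a \<in> carrier R" and x: "x \<in> carrier M" for a x
  proof -
    have "N +>\<^bsub>M\<^esub> (a \<odot>\<^bsub>M\<^esub> y) = N +>\<^bsub>M\<^esub> (a \<odot>\<^bsub>M\<^esub> x)" if y: "y \<in> N +>\<^bsub>M\<^esub> x" for y
    proof -
      obtain n where n: "n \<in> N" "y = n \<oplus>\<^bsub>M\<^esub> x"
        using y by (auto simp: a_r_coset_def')
      have "a \<odot>\<^bsub>M\<^esub> y = a \<odot>\<^bsub>M\<^esub> n \<oplus>\<^bsub>M\<^esub> a \<odot>\<^bsub>M\<^esub> x"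
        using n a x submoduleD(1)[OF N] by (simp add: smult_r_distr subset_iff)
      then have "a \<odot>\<^bsub>M\<^esub> y \<in> N +>\<^bsub>M\<^esub> (a \<odot>\<^bsub>M\<^esub> x)"
        using submoduleD(4)[OF N a n(1)] by (auto simp: a_r_coset_def')
      then show ?thesis
        using coset_cong a x by blast
    qed
    moreover have "x \<in> N +>\<^bsub>M\<^esub> x"
      using x by (rule N.a_rcos_self)
    ultimately show ?thesis
      by blast
  qed
  then show ?thesis
    using N.a_rcos_sum carrier_FactModule
    by (auto simp: left_module_hom_def) (auto simp: FactModule_def)
qed

lemma coset_eq_zero_iff:
  assumes "x \<in> carrier M"
  shows "N +>\<^bsub>M\<^esub> x = \<zero>\<^bsub>FactModule M N\<^esub> \<longleftrightarrow> x \<in> N"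
  using assms N.a_rcos_self[OF assms] N.a_rcos_const by (auto simp: FactModule_def)

lemma coset_epi: "left_module_epi R M (FactModule M N) (\<lambda>x. N +>\<^bsub>M\<^esub> x)"
  using left_module_axioms left_module_FactModule[OF N] coset_hom carrier_FactModule
  by (intro left_module_epi.intro left_module_epi_axioms.intro) auto

lemma coset_kernel: "a_kernel M (FactModule M N) (\<lambda>x. N +>\<^bsub>M\<^esub> x) = N"
  using coset_eq_zero_iff submoduleD(1)[OF N] by (auto simp: a_kernel_def')

corollary weakly_supplemented_FactModule:
  assumes "weakly_supplemented R M"
  shows "weakly_supplemented R (FactModule M N)"
  using left_module_epi.weakly_supplemented_image[OF coset_epi assms] .

text \<open>
  Restricted to a supplement \<open>L\<close> of \<open>N\<close>, the projection onto \<open>M / N\<close> is still surjective, and its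
  kernel \<open>N \<inter> L\<close> is small in \<open>L\<close>: if \<open>(N \<inter> L) + T = L\<close>, then \<open>N + T = N + L = M\<close>, so \<open>T = L\<close> by
  the minimality of \<open>L\<close>.
\<close>

lemma weakly_supplemented_supplement:
  assumes ws: "weakly_supplemented R M" and sup: "supplement_of R M N L"
  shows "weakly_supplemented R (M\<lparr>carrier := L\<rparr>)"
proof -
  let ?L = "M\<lparr>carrier := L\<rparr>" and ?f = "\<lambda>x. N +>\<^bsub>M\<^esub> x"
  have L: "submodule L R M" "N <+>\<^bsub>M\<^esub> L = carrier M"
    and min: "\<And>T. submodule T R M \<Longrightarrow> T \<subseteq> L \<Longrightarrow> N <+>\<^bsub>M\<^esub> T = carrier M \<Longrightarrow> T = L"
    using sup by (auto simp: supplement_of_def)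
  note subN = submoduleD(1)[OF N] and subL = submoduleD(1)[OF L(1)]
  interpret C: left_module_epi R M "FactModule M N" ?f
    by (rule coset_epi)
  have "?f ` L = carrier (FactModule M N)"
  proof -
    have "carrier (FactModule M N) \<subseteq> ?f ` L"
    proof
      fix X assume "X \<in> carrier (FactModule M N)"
      then obtain x where x: "x \<in> carrier M" "X = ?f x"
        unfolding carrier_FactModule by auto
      then obtain n l where nl: "n \<in> N" "l \<in> L" "x = n \<oplus>\<^bsub>M\<^esub> l"
        using L(2) mem_sum by blast
      then have "x \<in> ?f l"
        by (auto simp: a_r_coset_def')
      then have "?f l = ?f x"
        using coset_cong[of l x] nl subL by auto
      then show "X \<in> ?f ` L"
        using x nl by auto
    qed
    then show ?thesis
      using C.closed subL by auto
  qed
  then interpret L: left_module_epi R ?L "FactModule M N" ?f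
    using left_module_submodule[OF L(1)] C.B.left_module_axioms C.hom subL
    by (intro left_module_epi.intro left_module_epi_axioms.intro)
      (auto simp: left_module_hom_def subset_iff)
  have ker: "a_kernel ?L (FactModule M N) ?f = N \<inter> L"
    using coset_eq_zero_iff subL by (auto simp: a_kernel_def')
  have "small_submodule R ?L (N \<inter> L)"
  proof (rule L.A.small_submoduleI)
    show "submodule (N \<inter> L) R ?L"
      using submodule_Int[OF N L(1)] by (simp add: submodule_restrict_iff[OF L(1)])
    fix T assume "submodule T R ?L" and "(N \<inter> L) <+>\<^bsub>?L\<^esub> T = carrier ?L"
    then have T: "submodule T R M" "T \<subseteq> L" and sum: "(N \<inter> L) <+>\<^bsub>M\<^esub> T = L"
      by (auto simp: submodule_restrict_iff[OF L(1)] set_add_restrict)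
    have NT: "submodule (N <+>\<^bsub>M\<^esub> T) R M"
      by (rule submodule_set_add[OF N T(1)])
    have up: "N \<subseteq> N <+>\<^bsub>M\<^esub> T" "T \<subseteq> N <+>\<^bsub>M\<^esub> T"
      using set_add_upper1[OF subN T(1)] set_add_upper2[OF N submoduleD(1)[OF T(1)]] by auto
    then have "L \<subseteq> N <+>\<^bsub>M\<^esub> T"
      using set_add_least[OF NT, of "N \<inter> L" T] sum by auto
    then have "carrier M \<subseteq> N <+>\<^bsub>M\<^esub> T"
      using set_add_least[OF NT up(1)] L(2) by auto
    then have "T = L"
      using min[OF T] submoduleD(1)[OF NT] by auto
    then show "T = carrier ?L"
      by simp
  qed
  then show ?thesis
    using L.weakly_supplemented_small_cover weakly_supplemented_FactModule[OF ws] ker by simp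
qed

end

text \<open>
  If \<open>B + T = M\<close> with \<open>T \<subseteq> A\<close>, then the \<open>B\<close>-component of an element of \<open>A\<close> lies in \<open>A \<inter> B = 0\<close>,
  so the element is in \<open>T\<close>.
\<close>

lemma direct_sum_supplement:
  assumes "direct_sum_decomp R M A B"
  shows "supplement_of R M B A"
proof -
  have A: "submodule A R M" and B: "submodule B R M" and sum: "A <+>\<^bsub>M\<^esub> B = carrier M"
    and int: "A \<inter> B = {\<zero>\<^bsub>M\<^esub>}"
    using assms by (auto simp: direct_sum_decomp_def)
  note subA = submoduleD(1)[OF A, THEN subsetD] and subB = submoduleD(1)[OF B, THEN subsetD]
  have "B <+>\<^bsub>M\<^esub> A = carrier M"
    using sum set_add_comm[of A B] subA subB by auto
  moreover have "T = A" if T: "submodule T R M" "T \<subseteq> A" "B <+>\<^bsub>M\<^esub> T = carrier M" for T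
  proof -
    have "x \<in> T" if x: "x \<in> A" for x
    proof -
      obtain b t where bt: "b \<in> B" "t \<in> T" "x = b \<oplus>\<^bsub>M\<^esub> t"
        using T(3) subA[OF x] mem_sum by blast
      then have "b \<in> A"
        using submodule_cancel'[OF A, of b t] T(2) x subB by auto
      then have "b = \<zero>\<^bsub>M\<^esub>"
        using bt int by auto
      then show ?thesis
        using bt T(2) subA by auto
    qed
    then show ?thesis
      using T(2) by auto
  qed
  ultimately show ?thesis
    using A by (auto simp: supplement_of_def)
qed

lemma weakly_supplemented_direct_summand:
  assumes "weakly_supplemented R M" and "direct_sum_decomp R M A B"
  shows "weakly_supplemented R (M\<lparr>carrier := A\<rparr>)"
  using assms(2) weakly_supplemented_supplement[OF _ assms(1) direct_sum_supplement[OF assms(2)]]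
  by (simp add: direct_sum_decomp_def)

lemma direct_sum_decomp_sym:
  assumes "direct_sum_decomp R M A B"
  shows "direct_sum_decomp R M B A"
  using assms set_add_comm[of A B] submoduleD(1)[of A] submoduleD(1)[of B]
  by (simp add: direct_sum_decomp_def Int_commute)

end

section \<open>Semisimplicity and semilocality\<close>

context left_module
begin

text \<open>
  Let \<open>T\<close> be a complement of the sum of all simple submodules. If \<open>T\<close> is nonzero, a maximal submodule
  \<open>K\<close> misses one of its points. A complement of \<open>T \<inter> K\<close> inside \<open>T\<close> embeds into the simple module
  \<open>M / K\<close>, so it is simple, which contradicts the choice of \<open>T\<close>.
\<close>

theorem semisimple_of_radical_zero:
  assumes ws: "weakly_supplemented R M" and rad: "radical R M = {\<zero>\<^bsub>M\<^esub>}"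
  shows "semisimple_module R M"
proof -
  have compl: "\<exists>L. direct_sum_decomp R M N L" if N: "submodule N R M" for N
  proof -
    obtain L where L: "submodule L R M" "N <+>\<^bsub>M\<^esub> L = carrier M" "small_submodule R M (N \<inter> L)"
      using ws N by (auto simp: weakly_supplemented_def weak_supplement_def)
    then have "N \<inter> L = {\<zero>\<^bsub>M\<^esub>}"
      using small_submodule_subset_radical[OF L(3)] rad submoduleD(2)[OF N] submoduleD(2)[OF L(1)]
      by auto
    then show ?thesis
      using N L by (auto simp: direct_sum_decomp_def)
  qed
  let ?simple = "{S. submodule S R M \<and> simple_module R (M\<lparr>carrier := S\<rparr>)}"
  define S where "S = submodule_sum R M ?simple"
  have S: "submodule S R M"
    unfolding S_def by (rule submodule_submodule_sum) (auto dest: submoduleD)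
  obtain T where T: "submodule T R M" "S <+>\<^bsub>M\<^esub> T = carrier M" "S \<inter> T = {\<zero>\<^bsub>M\<^esub>}"
    using compl[OF S] by (auto simp: direct_sum_decomp_def)
  have "T = {\<zero>\<^bsub>M\<^esub>}"
  proof (rule ccontr)
    assume "T \<noteq> {\<zero>\<^bsub>M\<^esub>}"
    then obtain t where t: "t \<in> T" "t \<noteq> \<zero>\<^bsub>M\<^esub>"
      using submoduleD(2)[OF T(1)] by auto
    note subT = submoduleD(1)[OF T(1), THEN subsetD]
    have "t \<notin> radical R M"
      using t rad by auto
    then obtain K where "maximal_submodule R M K" and tK: "t \<notin> K"
      using subT[OF t(1)] by (auto simp: radical_def)
    then have K: "submodule K R M"
      and max: "\<And>L. submodule L R M \<Longrightarrow> K \<subseteq> L \<Longrightarrow> L = K \<or> L = carrier M"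
      by (auto simp: maximal_submodule_def)
    obtain C where C: "submodule C R M" "(T \<inter> K) <+>\<^bsub>M\<^esub> C = carrier M" "T \<inter> K \<inter> C = {\<zero>\<^bsub>M\<^esub>}"
      using compl[OF submodule_Int[OF T(1) K]] by (auto simp: direct_sum_decomp_def)
    note subK = submoduleD(1)[OF K, THEN subsetD] and subC = submoduleD(1)[OF C(1), THEN subsetD]
    let ?U = "T \<inter> C"
    have U: "submodule ?U R M"
      by (rule submodule_Int[OF T(1) C(1)])
    have U_nonzero: "?U \<noteq> {\<zero>\<^bsub>M\<^esub>}"
    proof
      assume U0: "?U = {\<zero>\<^bsub>M\<^esub>}"
      obtain k c where kc: "k \<in> T \<inter> K" "c \<in> C" "t = k \<oplus>\<^bsub>M\<^esub> c"
        using C(2) subT[OF t(1)] mem_sum by blast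
      then have "c \<in> T"
        using submodule_cancel[OF T(1), of k c] t subC by auto
      then have "c = \<zero>\<^bsub>M\<^esub>"
        using kc U0 by blast
      then have "t \<in> K"
        using kc subK by auto
      then show False
        using tK by simp
    qed
    have "simple_module R (M\<lparr>carrier := ?U\<rparr>)"
      unfolding simple_module_def submodule_restrict_iff[OF U]
    proof (intro conjI allI impI)
      show "carrier (M\<lparr>carrier := ?U\<rparr>) \<noteq> {\<zero>\<^bsub>M\<lparr>carrier := ?U\<rparr>\<^esub>}"
        using U_nonzero by simp
      fix V assume "submodule V R M \<and> V \<subseteq> ?U"
      then have V: "submodule V R M" "V \<subseteq> ?U"
        by auto
      have up: "K \<subseteq> K <+>\<^bsub>M\<^esub> V" "V \<subseteq> K <+>\<^bsub>M\<^esub> V"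
        using set_add_upper1 set_add_upper2 submoduleD(1) K V(1) by auto
      from max[OF submodule_set_add[OF K V(1)] up(1)]
      show "V = {\<zero>\<^bsub>M\<lparr>carrier := ?U\<rparr>\<^esub>} \<or> V = carrier (M\<lparr>carrier := ?U\<rparr>)"
      proof
        assume "K <+>\<^bsub>M\<^esub> V = K"
        then have "V \<subseteq> {\<zero>\<^bsub>M\<^esub>}"
          using up V(2) C(3) by auto
        then show ?thesis
          using submoduleD(2)[OF V(1)] by auto
      next
        assume KV: "K <+>\<^bsub>M\<^esub> V = carrier M"
        have "u \<in> V" if u: "u \<in> ?U" for u
        proof -
          obtain k v where kv: "k \<in> K" "v \<in> V" "u = k \<oplus>\<^bsub>M\<^esub> v"
            using KV u subT mem_sum by blast
          then have "k \<in> ?U"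
            using submodule_cancel'[OF U, of k v] V(2) u subK by auto
          then have "k = \<zero>\<^bsub>M\<^esub>"
            using C(3) kv(1) by auto
          then show ?thesis
            using kv V(2) subT by auto
        qed
        then show ?thesis
          using V(2) by auto
      qed
    qed
    then have "?U \<subseteq> S"
      unfolding S_def submodule_sum_def using U by blast
    then have "?U \<subseteq> {\<zero>\<^bsub>M\<^esub>}"
      using T(3) by auto
    then show False
      using U_nonzero submoduleD(2)[OF U] by auto
  qed
  then have "carrier M \<subseteq> S"
    using T(2) set_add_least[OF S, of S T] submoduleD(2)[OF S] by auto
  then show ?thesis
    using submoduleD(1)[OF S] by (auto simp: semisimple_module_def S_def)
qed

corollary weakly_supplemented_semilocal:
  assumes ws: "weakly_supplemented R M"
  shows "semilocal_module R M"
proof -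
  note N = submodule_radical
  interpret Q: left_module_epi R M "FactModule M (radical R M)" "\<lambda>x. radical R M +>\<^bsub>M\<^esub> x"
    by (rule coset_epi[OF N])
  show ?thesis
    unfolding semilocal_module_def
    by (rule Q.B.semisimple_of_radical_zero[OF weakly_supplemented_FactModule[OF N ws]
          Q.radical_image_zero[OF coset_kernel[OF N]]])
qed

end

section \<open>Splitting off a semisimple summand\<close>

context left_module
begin

text \<open>Zorn's lemma applies because a union of a chain of submodules is a submodule.\<close>

lemma ex_maximal_disjoint_submodule:
  assumes E: "submodule E R M"
  obtains K where "submodule K R M" and "K \<inter> E = {\<zero>\<^bsub>M\<^esub>}"
    and "\<And>L. submodule L R M \<Longrightarrow> K \<subseteq> L \<Longrightarrow> L \<inter> E = {\<zero>\<^bsub>M\<^esub>} \<Longrightarrow> L = K"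
proof -
  let ?\<A> = "{K. submodule K R M \<and> K \<inter> E = {\<zero>\<^bsub>M\<^esub>}}"
  have "\<exists>K\<in>?\<A>. \<forall>L\<in>?\<A>. K \<subseteq> L \<longrightarrow> L = K"
  proof (rule subset_Zorn_nonempty)
    show "?\<A> \<noteq> {}"
      using submodule_zero submoduleD(2)[OF E] by auto
    fix \<C> assume ne: "\<C> \<noteq> {}" and chain: "subset.chain ?\<A> \<C>"
    have sub: "submodule K R M" "K \<inter> E = {\<zero>\<^bsub>M\<^esub>}" if "K \<in> \<C>" for K
      using chain that by (auto simp: subset.chain_def)
    have "submodule (\<Union>\<C>) R M"
    proof (rule submoduleI)
      show "\<Union>\<C> \<subseteq> carrier M" and "\<zero>\<^bsub>M\<^esub> \<in> \<Union>\<C>"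
        using sub(1) submoduleD(1,2) ne by blast+
      show "a \<odot>\<^bsub>M\<^esub> x \<in> \<Union>\<C>" if "a \<in> carrier R" "x \<in> \<Union>\<C>" for a x
        using that sub(1) submoduleD(4) by blast
      fix x y assume "x \<in> \<Union>\<C>" "y \<in> \<Union>\<C>"
      then obtain X Y where XY: "X \<in> \<C>" "Y \<in> \<C>" "x \<in> X" "y \<in> Y"
        by auto
      then have "X \<subseteq> Y \<or> Y \<subseteq> X"
        using chain by (auto simp: subset.chain_def)
      then show "x \<oplus>\<^bsub>M\<^esub> y \<in> \<Union>\<C>"
        using XY sub(1) submoduleD(3) by blast
    qed
    moreover have "\<Union>\<C> \<inter> E = {\<zero>\<^bsub>M\<^esub>}"
      using sub(2) ne by blast
    ultimately show "\<Union>\<C> \<in> ?\<A>"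
      by simp
  qed
  then obtain K where "K \<in> ?\<A>" and "\<forall>L\<in>?\<A>. K \<subseteq> L \<longrightarrow> L = K"
    by (elim bexE)
  then show ?thesis
    by (intro that[of K]) auto
qed

text \<open>
  A weak supplement \<open>P\<close> of \<open>M\<^sub>1 + Rad(M)\<close> need not contain \<open>Rad(M)\<close>, but \<open>M\<^sub>2 = P + Rad(M)\<close> does, and
  by the modular law the passage to \<open>M\<^sub>2\<close> adds only \<open>Rad(M)\<close> to the intersection with \<open>M\<^sub>1 + Rad(M)\<close>.
\<close>

lemma semisimple_radical_essential_decomp:
  assumes ws: "weakly_supplemented R M"
  obtains M1 M2 where "direct_sum_decomp R M M1 M2"
    and "semisimple_module R (M\<lparr>carrier := M1\<rparr>)"
    and "essential_submodule R (M\<lparr>carrier := M2\<rparr>) (radical R M)"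
proof -
  let ?J = "radical R M"
  note J = submodule_radical
  obtain M1 where M1: "submodule M1 R M" "M1 \<inter> ?J = {\<zero>\<^bsub>M\<^esub>}"
    and max: "\<And>L. submodule L R M \<Longrightarrow> M1 \<subseteq> L \<Longrightarrow> L \<inter> ?J = {\<zero>\<^bsub>M\<^esub>} \<Longrightarrow> L = M1"
    using ex_maximal_disjoint_submodule[OF J] by blast
  note sub1 = submoduleD(1)[OF M1(1), THEN subsetD]
  let ?N = "M1 <+>\<^bsub>M\<^esub> ?J"
  have N: "submodule ?N R M"
    by (rule submodule_set_add[OF M1(1) J])
  have upN: "M1 \<subseteq> ?N" "?J \<subseteq> ?N"
    by (rule set_add_upper1[OF submoduleD(1)[OF M1(1)] J])
      (rule set_add_upper2[OF M1(1) submoduleD(1)[OF J]])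
  obtain P where P: "submodule P R M" "?N <+>\<^bsub>M\<^esub> P = carrier M" "small_submodule R M (?N \<inter> P)"
    using ws N by (auto simp: weakly_supplemented_def weak_supplement_def)
  note subP = submoduleD(1)[OF P(1), THEN subsetD]
  define M2 where "M2 = P <+>\<^bsub>M\<^esub> ?J"
  have M2: "submodule M2 R M"
    unfolding M2_def by (rule submodule_set_add[OF P(1) J])
  note sub2 = submoduleD(1)[OF M2, THEN subsetD]
  have up2: "P \<subseteq> M2" "?J \<subseteq> M2"
    unfolding M2_def
    by (rule set_add_upper1[OF submoduleD(1)[OF P(1)] J])
      (rule set_add_upper2[OF P(1) submoduleD(1)[OF J]])

  \<comment> \<open>The component in \<open>P\<close> lies in the small submodule \<open>(M\<^sub>1 + Rad(M)) \<inter> P\<close>, hence in \<open>Rad(M)\<close>.\<close>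
  have "x \<in> ?J" if x: "x \<in> ?N" "x \<in> M2" for x
  proof -
    obtain p r where pr: "p \<in> P" "r \<in> ?J" "x = p \<oplus>\<^bsub>M\<^esub> r"
      using x(2) unfolding M2_def mem_sum by blast
    then have "p \<in> ?N"
      using submodule_cancel'[OF N, of p r] upN x(1) subP by auto
    then have "p \<in> ?J"
      using small_submodule_subset_radical[OF P(3)] pr by auto
    then show ?thesis
      using pr submoduleD(3)[OF J] by auto
  qed
  then have int: "M1 \<inter> M2 = {\<zero>\<^bsub>M\<^esub>}"
    using upN M1(2) submoduleD(2)[OF M1(1)] submoduleD(2)[OF M2] by blast

  have S: "submodule (M1 <+>\<^bsub>M\<^esub> M2) R M"
    by (rule submodule_set_add[OF M1(1) M2])
  have upS: "M1 \<subseteq> M1 <+>\<^bsub>M\<^esub> M2" "M2 \<subseteq> M1 <+>\<^bsub>M\<^esub> M2"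
    by (rule set_add_upper1[OF submoduleD(1)[OF M1(1)] M2])
      (rule set_add_upper2[OF M1(1) submoduleD(1)[OF M2]])
  have "?N \<subseteq> M1 <+>\<^bsub>M\<^esub> M2"
    using set_add_least[OF S upS(1)] upS(2) up2 by auto
  then have "carrier M \<subseteq> M1 <+>\<^bsub>M\<^esub> M2"
    using set_add_least[OF S, of ?N P] upS(2) up2 P(2) by auto
  then have sum: "M1 <+>\<^bsub>M\<^esub> M2 = carrier M"
    using submoduleD(1)[OF S] by auto
  have decomp: "direct_sum_decomp R M M1 M2"
    using M1(1) M2 sum int by (simp add: direct_sum_decomp_def)

  interpret M1: left_module R "M\<lparr>carrier := M1\<rparr>"
    by (rule left_module_submodule[OF M1(1)])
  have "radical R (M\<lparr>carrier := M1\<rparr>) \<subseteq> M1 \<inter> ?J"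
    using radical_restrict_subset[OF M1(1)] by (auto simp: radical_def)
  then have "radical R (M\<lparr>carrier := M1\<rparr>) = {\<zero>\<^bsub>M\<lparr>carrier := M1\<rparr>\<^esub>}"
    using M1(2) M1.submoduleD(2)[OF M1.submodule_radical] by auto
  then have ss: "semisimple_module R (M\<lparr>carrier := M1\<rparr>)"
    by (rule M1.semisimple_of_radical_zero[OF weakly_supplemented_direct_summand[OF ws decomp]])

  have "essential_submodule R (M\<lparr>carrier := M2\<rparr>) ?J"
    unfolding essential_submodule_def submodule_restrict_iff[OF M2]
  proof (intro conjI allI impI)
    fix K assume "(submodule K R M \<and> K \<subseteq> M2) \<and> K \<noteq> {\<zero>\<^bsub>M\<lparr>carrier := M2\<rparr>\<^esub>}"
    then have K: "submodule K R M" "K \<subseteq> M2" "K \<noteq> {\<zero>\<^bsub>M\<^esub>}"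
      by auto
    show "?J \<inter> K \<noteq> {\<zero>\<^bsub>M\<lparr>carrier := M2\<rparr>\<^esub>}"
    proof
      assume "?J \<inter> K = {\<zero>\<^bsub>M\<lparr>carrier := M2\<rparr>\<^esub>}"
      then have JK: "?J \<inter> K = {\<zero>\<^bsub>M\<^esub>}"
        by simp
      have MK: "submodule (M1 <+>\<^bsub>M\<^esub> K) R M"
        by (rule submodule_set_add[OF M1(1) K(1)])
      \<comment> \<open>\<open>Rad(M)\<close> lies in \<open>M\<^sub>2\<close>, so an element \<open>m + k\<close> of it has \<open>m \<in> M\<^sub>1 \<inter> M\<^sub>2\<close>.\<close>
      have "r = \<zero>\<^bsub>M\<^esub>" if r: "r \<in> M1 <+>\<^bsub>M\<^esub> K" "r \<in> ?J" for r
      proof -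
        obtain m k where mk: "m \<in> M1" "k \<in> K" "r = m \<oplus>\<^bsub>M\<^esub> k"
          using r(1) mem_sum by blast
        then have "m \<in> M2"
          using submodule_cancel'[OF M2, of m k] K(2) up2 r(2) sub1 by auto
        then have "m = \<zero>\<^bsub>M\<^esub>"
          using mk int by auto
        then have "r = k"
          using mk K(2) sub2 by auto
        then show ?thesis
          using mk r(2) JK by auto
      qed
      then have "(M1 <+>\<^bsub>M\<^esub> K) \<inter> ?J = {\<zero>\<^bsub>M\<^esub>}"
        using submoduleD(2)[OF MK] submoduleD(2)[OF J] by blast
      then have "M1 <+>\<^bsub>M\<^esub> K = M1"
        by (intro max[OF MK] set_add_upper1[OF submoduleD(1)[OF M1(1)] K(1)])
      then have "K \<subseteq> M1"
        using set_add_upper2[OF M1(1) submoduleD(1)[OF K(1)]] by simp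
      then show False
        using K int submoduleD(2)[OF K(1)] by auto
    qed
  qed (use J up2 in auto)
  then show ?thesis
    using that decomp ss by blast
qed

end

section \<open>Consequences of being weakly supplemented\<close>

theorem proposition2p2:
  fixes R :: "('r, 'x) ring_scheme"
    and M :: "('r, 'm, 'y) module_scheme"
  assumes "left_module R M"
    and "weakly_supplemented R M"
  shows "semilocal_module R M \<and>
    (\<exists>M1 M2. direct_sum_decomp R M M1 M2 \<and>
       semisimple_module R (M\<lparr>carrier := M1\<rparr>) \<and>
       semilocal_module R (M\<lparr>carrier := M2\<rparr>) \<and>
       essential_submodule R (M\<lparr>carrier := M2\<rparr>) (radical R M)) \<and>
    (\<forall>N. submodule N R M \<longrightarrow> weakly_supplemented R (FactModule M N)) \<and>
    (\<forall>N :: ('r, 'n, 'z) module_scheme. small_cover R N M \<longrightarrow> weakly_supplemented R N) \<and>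
    (\<forall>L. supplement_in R M L \<longrightarrow> weakly_supplemented R (M\<lparr>carrier := L\<rparr>)) \<and>
    (\<forall>L. direct_summand R M L \<longrightarrow> weakly_supplemented R (M\<lparr>carrier := L\<rparr>))"
proof -
  interpret left_module R M by (rule assms(1))
  note ws = assms(2)
  obtain M1 M2 where decomp: "direct_sum_decomp R M M1 M2"
    and ss: "semisimple_module R (M\<lparr>carrier := M1\<rparr>)"
    and ess: "essential_submodule R (M\<lparr>carrier := M2\<rparr>) (radical R M)"
    using semisimple_radical_essential_decomp[OF ws] by blast
  have "submodule M2 R M"
    using decomp by (simp add: direct_sum_decomp_def)
  then have sl: "semilocal_module R (M\<lparr>carrier := M2\<rparr>)"
    using left_module.weakly_supplemented_semilocal[OF left_module_submodule]
      weakly_supplemented_direct_summand[OF ws direct_sum_decomp_sym[OF decomp]]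
    by blast
  have cover: "weakly_supplemented R N" if N: "small_cover R N M"
    for N :: "('r, 'n, 'z) module_scheme"
  proof -
    obtain f where f: "left_module_epi R N M f" "small_submodule R N (a_kernel N M f)"
      using N assms(1) unfolding small_cover_def
      by (blast intro: left_module_epi.intro left_module_epi_axioms.intro)
    show ?thesis
      using left_module_epi.weakly_supplemented_small_cover[OF f ws] .
  qed
  show ?thesis
    using weakly_supplemented_semilocal[OF ws] decomp ss sl ess cover
      weakly_supplemented_FactModule[OF _ ws] weakly_supplemented_supplement[OF _ ws]
      weakly_supplemented_direct_summand[OF ws]
    unfolding supplement_in_def direct_summand_def by blast
qed

end
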